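(* Let $G$ be a group generated as a monoid by a subset $A\subseteq G$ closed under $G$-conjugation, and let $c\in G$ with $\mathrm{Red}_A(c)$ finite. Let $\prec$ be a linear order of $A_c$. Then the natural labeling $\lambda_c$ is an EL-labeling of $\mathcal{P}_c(G,A)$ with respect to $\prec$ if and only if $\prec$ is $c$-compatible and $\mathcal{P}_c(G,A)$ is totally well-covered with respect to $\prec$.
   Context: For $x\in G$, $\ell_A(x)$ is the least $k\ge 0$ such that $x$ is a product of $k$ elements of $A$; such a product with $k=\ell_A(x)$, written as a tuple, is a reduced $A$-factorization, and $\mathrm{Red}_A(x)$ is the set of these. $x\le_A y$ iff $\ell_A(x)+\ell_A(x^{-1}y)=\ell_A(y)$, $\lessdot_A$ denotes a cover relation, $\mathcal{P}_g=[e,g]_A$ ordered by $\le_A$, and $A_g=\{a\in A: a\le_A g\}$. The natural labeling assigns to each cover $x\lessdot_A y$ in $\mathcal{P}_c$ the label $\lambda_c(x,y)=x^{-1}y\in A_c$. It is an EL-labeling with respect to $\prec$ if in every interval of $\mathcal{P}_c$ there is a unique maximal chain whose label sequence is weakly increasing with respect to $\prec$, and its label sequence is lexicographically smaller than that of every other maximal chain of that interval. A linear order $\prec$ on $A_c$ is $c$-compatible if every $g\le_A c$ with $\ell_A(g)=2$ has exactly one reduced $A$-factorization $(a,b)$ with $a\preceq b$. For $a\in A_c$, $F_\prec(a;c)=\{g: a\lessdot_A g\le_A c$ and there is $a'\in A_c$ with $a'\prec a$, $a'\lessdot_A g\}$; $\mathcal{P}_c$ is well-covered with respect to $\prec$ if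 $F_\prec(a;c)=\emptyset$ exactly when $a=\min_\prec A_c$, and totally well-covered if for every $g\in\mathcal{P}_c$, $\mathcal{P}_g$ is well-covered with respect to the restriction of $\prec$ to $A_g$.
   Formalization: The identity is left out of A_g (A_g = {a in A : a ≠ e, a ≤_A g}), and the order ≺ is on this set; if e lies in A the literal claim fails (G = Z, A = {-1,0,1}, c = 1), and if e is not in A nothing changes. *)

theory Defs
  imports "HOL-Algebra.Group"
begin

section \<open>Generated groups\<close>

definition word_prod :: "('a, 'b) monoid_scheme \<Rightarrow> 'a list \<Rightarrow> 'a" where
  "word_prod G w = foldr (\<otimes>\<^bsub>G\<^esub>) w \<one>\<^bsub>G\<^esub>"

definition generated_as_monoid :: "('a, 'b) monoid_scheme \<Rightarrow> 'a set \<Rightarrow> bool" where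
  "generated_as_monoid G A \<longleftrightarrow>
     A \<subseteq> carrier G \<and> (\<forall>x\<in>carrier G. \<exists>w. set w \<subseteq> A \<and> word_prod G w = x)"

definition conj_closed :: "('a, 'b) monoid_scheme \<Rightarrow> 'a set \<Rightarrow> bool" where
  "conj_closed G A \<longleftrightarrow> (\<forall>g\<in>carrier G. \<forall>a\<in>A. g \<otimes>\<^bsub>G\<^esub> a \<otimes>\<^bsub>G\<^esub> inv\<^bsub>G\<^esub> g \<in> A)"

definition word_length :: "('a, 'b) monoid_scheme \<Rightarrow> 'a set \<Rightarrow> 'a \<Rightarrow> nat" where
  "word_length G A x = (LEAST k. \<exists>w. length w = k \<and> set w \<subseteq> A \<and> word_prod G w = x)"

definition Red :: "('a, 'b) monoid_scheme \<Rightarrow> 'a set \<Rightarrow> 'a \<Rightarrow> 'a list set" where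
  "Red G A x = {w. set w \<subseteq> A \<and> word_prod G w = x \<and> length w = word_length G A x}"

definition prefix_le :: "('a, 'b) monoid_scheme \<Rightarrow> 'a set \<Rightarrow> 'a \<Rightarrow> 'a \<Rightarrow> bool" where
  "prefix_le G A x y \<longleftrightarrow> x \<in> carrier G \<and> y \<in> carrier G \<and>
     word_length G A x + word_length G A (inv\<^bsub>G\<^esub> x \<otimes>\<^bsub>G\<^esub> y) = word_length G A y"

section \<open>Labeled posets\<close>

definition strict :: "('a \<Rightarrow> 'a \<Rightarrow> bool) \<Rightarrow> 'a \<Rightarrow> 'a \<Rightarrow> bool" where
  "strict leq x y \<longleftrightarrow> leq x y \<and> x \<noteq> y"

definition covered_by :: "('a \<Rightarrow> 'a \<Rightarrow> bool) \<Rightarrow> 'a \<Rightarrow> 'a \<Rightarrow> bool" where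
  "covered_by leq x y \<longleftrightarrow> strict leq x y \<and> \<not> (\<exists>z. strict leq x z \<and> strict leq z y)"

definition interval :: "'a set \<Rightarrow> ('a \<Rightarrow> 'a \<Rightarrow> bool) \<Rightarrow> 'a \<Rightarrow> 'a \<Rightarrow> 'a set" where
  "interval P leq x y = {z \<in> P. leq x z \<and> leq z y}"

text \<open>A finite maximal chain is represented by the list of its elements in increasing order.\<close>

definition maximal_chains :: "'a set \<Rightarrow> ('a \<Rightarrow> 'a \<Rightarrow> bool) \<Rightarrow> 'a list set" where
  "maximal_chains I leq = {xs. sorted_wrt (strict leq) xs \<and> pred_on.maxchain I (strict leq) (set xs)}"

text \<open>Consecutive elements of a maximal chain of an interval form cover relations, so the
  labeling is only ever evaluated at covers.\<close>

definition label_seq :: "('a \<Rightarrow> 'a \<Rightarrow> 'l) \<Rightarrow> 'a list \<Rightarrow> 'l list" where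
  "label_seq lam xs = map2 lam (butlast xs) (tl xs)"

text \<open>Linear orders are reflexive relations \<open>r\<close> as in \<open>linear_order_on\<close>; thus \<open>(a, b) \<in> r\<close> is the
  weak order and \<open>(a, b) \<in> r - Id\<close> the strict one.\<close>

definition rising :: "('l \<times> 'l) set \<Rightarrow> 'l list \<Rightarrow> bool" where
  "rising r ls \<longleftrightarrow> successively (\<lambda>a b. (a, b) \<in> r) ls"

definition EL_labeling ::
    "'a set \<Rightarrow> ('a \<Rightarrow> 'a \<Rightarrow> bool) \<Rightarrow> ('a \<Rightarrow> 'a \<Rightarrow> 'l) \<Rightarrow> ('l \<times> 'l) set \<Rightarrow> bool" where
  "EL_labeling P leq lam r \<longleftrightarrow>
     (\<forall>x\<in>P. \<forall>y\<in>P. leq x y \<longrightarrow>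
       (let M = maximal_chains (interval P leq x y) leq in
         (\<exists>!xs. xs \<in> M \<and> rising r (label_seq lam xs)) \<and>
         (\<forall>xs\<in>M. rising r (label_seq lam xs) \<longrightarrow>
           (\<forall>ys\<in>M. ys \<noteq> xs \<longrightarrow> (label_seq lam xs, label_seq lam ys) \<in> lexord (r - Id)))))"

section \<open>Factorization posets\<close>

definition fact_poset :: "('a, 'b) monoid_scheme \<Rightarrow> 'a set \<Rightarrow> 'a \<Rightarrow> 'a set" where
  "fact_poset G A g = interval (carrier G) (prefix_le G A) \<one>\<^bsub>G\<^esub> g"

text \<open>The set \<open>A\<^sub>g\<close> of atoms of \<open>fact_poset G A g\<close>. It is \<open>{a \<in> A. a \<le>\<^sub>A g}\<close>, except that the
  identity, which is no atom and never occurs in a reduced factorization, is left out in case it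
  belongs to \<open>A\<close>; it would otherwise be an element \<open>a\<close> of \<open>A\<^sub>g\<close> with \<open>F(a; g) = {}\<close> for every
  linear order.\<close>

definition gens_below :: "('a, 'b) monoid_scheme \<Rightarrow> 'a set \<Rightarrow> 'a \<Rightarrow> 'a set" where
  "gens_below G A g = {a \<in> A. a \<noteq> \<one>\<^bsub>G\<^esub> \<and> prefix_le G A a g}"

definition natural_label :: "('a, 'b) monoid_scheme \<Rightarrow> 'a \<Rightarrow> 'a \<Rightarrow> 'a" where
  "natural_label G x y = inv\<^bsub>G\<^esub> x \<otimes>\<^bsub>G\<^esub> y"

definition compatible :: "('a, 'b) monoid_scheme \<Rightarrow> 'a set \<Rightarrow> 'a \<Rightarrow> ('a \<times> 'a) set \<Rightarrow> bool" where
  "compatible G A c r \<longleftrightarrow>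
     (\<forall>g. prefix_le G A g c \<and> word_length G A g = 2 \<longrightarrow>
       (\<exists>!p. [fst p, snd p] \<in> Red G A g \<and> p \<in> r))"

definition F_set ::
    "('a, 'b) monoid_scheme \<Rightarrow> 'a set \<Rightarrow> ('a \<times> 'a) set \<Rightarrow> 'a \<Rightarrow> 'a \<Rightarrow> 'a set" where
  "F_set G A r a c =
     {g. covered_by (prefix_le G A) a g \<and> prefix_le G A g c \<and>
         (\<exists>a'\<in>gens_below G A c. (a', a) \<in> r - Id \<and> covered_by (prefix_le G A) a' g)}"

definition well_covered :: "('a, 'b) monoid_scheme \<Rightarrow> 'a set \<Rightarrow> 'a \<Rightarrow> ('a \<times> 'a) set \<Rightarrow> bool" where
  "well_covered G A c r \<longleftrightarrow>
     (\<forall>a\<in>gens_below G A c. F_set G A r a c = {} \<longleftrightarrow> (\<forall>b\<in>gens_below G A c. (a, b) \<in> r))"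

definition totally_well_covered ::
    "('a, 'b) monoid_scheme \<Rightarrow> 'a set \<Rightarrow> 'a \<Rightarrow> ('a \<times> 'a) set \<Rightarrow> bool" where
  "totally_well_covered G A c r \<longleftrightarrow>
     (\<forall>g\<in>fact_poset G A c. well_covered G A g (Restr r (gens_below G A g)))"

end

theory Submission
  imports Defs
begin

text \<open>Left translation identifies the interval \<open>[x, y]\<close> with \<open>[1, x\<inverse>y]\<close>, so that its maximal
  chains are the reduced factorizations of \<open>x\<inverse>y\<close>, and closure under conjugation makes \<open>x\<inverse>y\<close>
  again an element below \<open>c\<close>. Hence the natural labeling is an EL-labeling iff every \<open>g \<le> c\<close> has
  exactly one rising reduced factorization and this one is lexicographically first.

  Suppose this holds and \<open>a\<close> is an atom of \<open>g\<close> with \<open>F(a; g) = {}\<close>. Prepending \<open>a\<close> to the rising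
  factorization of \<open>a\<inverse>g\<close> gives a rising factorization of \<open>g\<close>, as a descent at its first position
  would put an element into \<open>F(a; g)\<close>; being lexicographically first, it starts with the least atom.

  Conversely, use induction on the length of \<open>g\<close>. The least atom \<open>a\<close> of \<open>g\<close> followed by the rising
  factorization of \<open>a\<inverse>g\<close> is rising and lexicographically first. A rising factorization starting
  with \<open>b \<noteq> a\<close> has as its second letter the least atom of \<open>b\<inverse>g\<close>, so for every \<open>h\<close> with
  \<open>b \<lessdot> h \<le> g\<close> the factorization of \<open>h\<close> starting with \<open>b\<close> is rising. For \<open>h\<close> in \<open>F(b; g)\<close>, the
  factorization starting with the least atom of \<open>h\<close> is another rising one, against compatibility.\<close>

section \<open>Sorted lists, finite linear orders and rising words\<close>

lemma sorted_wrt_strict_set_unique: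
  assumes "\<And>x y. P x y \<Longrightarrow> \<not> P y x"
    and "sorted_wrt P xs" and "sorted_wrt P ys" and "set xs = set ys"
  shows "xs = ys"
  using assms(2-)
proof (induction xs arbitrary: ys)
  case Nil
  then show ?case by simp
next
  case (Cons x xs)
  then obtain y ys' where ys: "ys = y # ys'"
    by (cases ys) auto
  have irr: "\<not> P z z" for z
    using assms(1) by blast
  \<comment> \<open>Different heads would each occur in the tail of the other list, so they would be
    related in both directions, against asymmetry.\<close>
  have "x = y"
  proof (rule ccontr)
    assume "x \<noteq> y"
    then have "x \<in> set ys'" "y \<in> set xs"
      using Cons.prems(3) ys by auto
    then have "P y x" "P x y"
      using Cons.prems ys by auto
    then show False
      using assms(1) by blast
  qed
  moreover have "x \<notin> set xs" "y \<notin> set ys'"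
    using Cons.prems ys irr by auto
  ultimately have "set xs = set ys'"
    using Cons.prems(3) ys by auto
  then show ?case
    using Cons ys \<open>x = y\<close> by auto
qed

lemma linear_order_on_finite_has_least:
  assumes "linear_order_on B r" and "S \<subseteq> B" and "finite S" and "S \<noteq> {}"
  obtains m where "m \<in> S" and "\<And>b. b \<in> S \<Longrightarrow> (m, b) \<in> r"
proof -
  have tot: "(a, b) \<in> r \<or> (b, a) \<in> r" if "a \<in> B" "b \<in> B" for a b
    using assms(1) that unfolding linear_order_on_def partial_order_on_def preorder_on_def
      total_on_def refl_on_def by metis
  have tr: "trans r"
    using assms(1) unfolding linear_order_on_def partial_order_on_def preorder_on_def by blast
  have "\<exists>m\<in>S. \<forall>b\<in>S. (m, b) \<in> r"
    using assms(3,4,2)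
  proof (induction rule: finite_ne_induct)
    case (singleton x)
    then show ?case using tot by auto
  next
    case (insert x F)
    then obtain m where m: "m \<in> F" "\<forall>b\<in>F. (m, b) \<in> r"
      by auto
    then have "(x, x) \<in> r" "(x, m) \<in> r \<or> (m, x) \<in> r"
      using insert.prems tot[of x x] tot[of x m] by auto
    then have "(\<forall>b\<in>insert x F. (m, b) \<in> r) \<or> (\<forall>b\<in>insert x F. (x, b) \<in> r)"
      using m transD[OF tr] by blast
    then show ?case
      using m(1) by blast
  qed
  then show ?thesis
    using that by blast
qed

lemma rising_Cons_Cons:
  "rising r (a # b # w) \<longleftrightarrow> (a, b) \<in> r \<and> rising r (b # w)"
  by (simp add: rising_def)

lemma rising_ConsD: "rising r (a # w) \<Longrightarrow> rising r w"
  by (cases w) (auto simp: rising_def)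

text \<open>The walk that starts at \<open>x\<close> and multiplies on the right by one letter of
  \<open>w\<close> at a time, so it has one entry more than \<open>w\<close>. Reduced words of
  x^{-1}y turn into the maximal chains of [x, y] this way.\<close>

definition partial_products :: "('a, 'b) monoid_scheme \<Rightarrow> 'a \<Rightarrow> 'a list \<Rightarrow> 'a list" where
  "partial_products G x w = map (\<lambda>k. x \<otimes>\<^bsub>G\<^esub> word_prod G (take k w)) [0..<Suc (length w)]"

text \<open>The EL condition for the interval [1, g], expressed by reduced words instead of chains.
  One clause about the other words \<open>v\<close> covers both uniqueness and lexicographic
  minimality.\<close>

definition rising_first :: "('a, 'b) monoid_scheme \<Rightarrow> 'a set \<Rightarrow> ('a \<times> 'a) set \<Rightarrow> 'a \<Rightarrow> bool" where
  "rising_first G A r g \<longleftrightarrow>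
     (\<exists>w\<in>Red G A g. rising r w \<and>
       (\<forall>v\<in>Red G A g. v \<noteq> w \<longrightarrow> \<not> rising r v \<and> (w, v) \<in> lexord (r - Id)))"

locale conj_generated_group = group G for G (structure) +
  fixes A :: "'a set"
  assumes generated: "generated_as_monoid G A"
    and conj_closed: "conj_closed G A"
begin

abbreviation len :: "'a \<Rightarrow> nat" where
  "len \<equiv> word_length G A"

abbreviation le :: "'a \<Rightarrow> 'a \<Rightarrow> bool" (infix "\<preceq>" 50) where
  "x \<preceq> y \<equiv> prefix_le G A x y"

section \<open>Word length\<close>

lemma gen_closed: "a \<in> A \<Longrightarrow> a \<in> carrier G"
  using generated by (auto simp: generated_as_monoid_def)

lemma inv_mult_cancel: "x \<in> carrier G \<Longrightarrow> y \<in> carrier G \<Longrightarrow> inv x \<otimes> (x \<otimes> y) = y"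
  by (simp add: m_assoc[symmetric])

lemma mult_inv_cancel: "x \<in> carrier G \<Longrightarrow> y \<in> carrier G \<Longrightarrow> x \<otimes> (inv x \<otimes> y) = y"
  by (simp add: m_assoc[symmetric])

lemma quotient_mult:
  "x \<in> carrier G \<Longrightarrow> y \<in> carrier G \<Longrightarrow> z \<in> carrier G \<Longrightarrow>
    (inv x \<otimes> y) \<otimes> (inv y \<otimes> z) = inv x \<otimes> z"
  by (simp add: m_assoc mult_inv_cancel)

lemma word_prod_Nil [simp]: "word_prod G [] = \<one>"
  by (simp add: word_prod_def)

lemma word_prod_Cons [simp]: "word_prod G (a # w) = a \<otimes> word_prod G w"
  by (simp add: word_prod_def)

lemma word_prod_closed: "set w \<subseteq> A \<Longrightarrow> word_prod G w \<in> carrier G"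
  by (induction w) (auto simp: gen_closed)

lemma word_prod_append:
  "set u \<subseteq> A \<Longrightarrow> set w \<subseteq> A \<Longrightarrow> word_prod G (u @ w) = word_prod G u \<otimes> word_prod G w"
  by (induction u) (auto simp: gen_closed word_prod_closed m_assoc)

lemma word_prod_conj:
  assumes "g \<in> carrier G" and "set w \<subseteq> A"
  shows "word_prod G (map (\<lambda>a. g \<otimes> a \<otimes> inv g) w) = g \<otimes> word_prod G w \<otimes> inv g"
  using assms(2)
proof (induction w)
  case Nil
  then show ?case using assms(1) by simp
next
  case (Cons a w)
  then have "a \<in> carrier G" "word_prod G w \<in> carrier G"
    by (auto simp: gen_closed word_prod_closed)
  then show ?case
    using Cons assms(1) by (simp add: m_assoc inv_mult_cancel)
qed

lemma RedD:
  assumes "w \<in> Red G A x"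
  shows "set w \<subseteq> A" and "word_prod G w = x" and "length w = len x"
  using assms by (auto simp: Red_def)

lemma Red_exists:
  assumes "x \<in> carrier G"
  obtains w where "w \<in> Red G A x"
proof -
  have "\<exists>k w. length w = k \<and> set w \<subseteq> A \<and> word_prod G w = x"
    using generated assms by (auto simp: generated_as_monoid_def)
  from LeastI_ex[OF this] show ?thesis
    using that by (auto simp: Red_def word_length_def)
qed

lemma len_word_prod_le: "set w \<subseteq> A \<Longrightarrow> len (word_prod G w) \<le> length w"
  unfolding word_length_def by (rule Least_le) auto

lemma len_mult_le:
  assumes "x \<in> carrier G" and "y \<in> carrier G"
  shows "len (x \<otimes> y) \<le> len x + len y"
proof -
  obtain u w where "u \<in> Red G A x" "w \<in> Red G A y"
    using Red_exists assms by metis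
  then show ?thesis
    using len_word_prod_le[of "u @ w"] by (auto simp: Red_def word_prod_append)
qed

lemma len_one [simp]: "len \<one> = 0"
  using len_word_prod_le[of "[]"] by simp

lemma len_eq_0_iff:
  assumes "x \<in> carrier G"
  shows "len x = 0 \<longleftrightarrow> x = \<one>"
proof -
  obtain w where "w \<in> Red G A x"
    using Red_exists assms .
  then show ?thesis
    using len_one by (auto simp: Red_def)
qed

lemma len_eq_1_iff:
  assumes "x \<in> carrier G"
  shows "len x = 1 \<longleftrightarrow> x \<in> A \<and> x \<noteq> \<one>"
proof
  assume *: "len x = 1"
  obtain w where w: "w \<in> Red G A x"
    using Red_exists assms .
  then obtain a where "w = [a]"
    using * by (auto simp: Red_def length_Suc_conv)
  then show "x \<in> A \<and> x \<noteq> \<one>"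
    using w * by (auto simp: Red_def gen_closed)
next
  assume "x \<in> A \<and> x \<noteq> \<one>"
  then show "len x = 1"
    using len_word_prod_le[of "[x]"] len_eq_0_iff[OF assms] assms by auto
qed

text \<open>Conjugating a reduced word letter by letter keeps its letters in \<open>A\<close> and
  its number of letters.\<close>

lemma len_conj_le:
  assumes "g \<in> carrier G" and "x \<in> carrier G"
  shows "len (g \<otimes> x \<otimes> inv g) \<le> len x"
proof -
  obtain w where w: "w \<in> Red G A x"
    using Red_exists assms(2) .
  have "set (map (\<lambda>a. g \<otimes> a \<otimes> inv g) w) \<subseteq> A"
    using RedD(1)[OF w] assms(1) conj_closed by (auto simp: conj_closed_def)
  from len_word_prod_le[OF this] show ?thesis
    using RedD[OF w] assms(1) by (simp add: word_prod_conj)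
qed

lemma len_conj:
  assumes "g \<in> carrier G" and "x \<in> carrier G"
  shows "len (inv g \<otimes> x \<otimes> g) = len x"
proof (rule antisym)
  show "len (inv g \<otimes> x \<otimes> g) \<le> len x"
    using len_conj_le[of "inv g" x] assms by simp
  have "g \<otimes> (inv g \<otimes> x \<otimes> g) \<otimes> inv g = x"
    using assms by (simp add: m_assoc mult_inv_cancel)
  then show "len x \<le> len (inv g \<otimes> x \<otimes> g)"
    using len_conj_le[of g "inv g \<otimes> x \<otimes> g"] assms by simp
qed

section \<open>The prefix order\<close>

lemma leD:
  assumes "x \<preceq> y"
  shows "x \<in> carrier G" and "y \<in> carrier G" and "len x + len (inv x \<otimes> y) = len y"
  using assms by (auto simp: prefix_le_def)

lemma le_mult_iff:
  "x \<in> carrier G \<Longrightarrow> y \<in> carrier G \<Longrightarrow> x \<preceq> x \<otimes> y \<longleftrightarrow> len (x \<otimes> y) = len x + len y"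
  by (auto simp: prefix_le_def inv_mult_cancel)

lemma le_refl: "x \<in> carrier G \<Longrightarrow> x \<preceq> x"
  by (simp add: prefix_le_def)

lemma one_le: "x \<in> carrier G \<Longrightarrow> \<one> \<preceq> x"
  by (simp add: prefix_le_def)

text \<open>The lengths leave 0 for the quotient, and only the identity has length 0. Antisymmetry
  and strict growth of length along the order both rest on this.\<close>

lemma le_len_eq:
  assumes "x \<preceq> y" and "len y \<le> len x"
  shows "x = y"
proof -
  note x = leD(1)[OF assms(1)] and y = leD(2)[OF assms(1)]
  have "len (inv x \<otimes> y) = 0"
    using leD(3)[OF assms(1)] assms(2) by simp
  then have "inv x \<otimes> y = \<one>"
    using x y by (simp add: len_eq_0_iff)
  then show ?thesis
    using x y mult_inv_cancel[of x y] by simp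
qed

lemma le_antisym: "x \<preceq> y \<Longrightarrow> y \<preceq> x \<Longrightarrow> x = y"
  by (erule le_len_eq, drule leD(3), linarith)

lemma strict_len_less: "strict (prefix_le G A) x y \<Longrightarrow> len x < len y"
  unfolding strict_def by (rule ccontr) (metis le_len_eq linorder_not_less)

text \<open>Subadditivity gives len z \<le> len x + len(x^{-1}z) \<le> len x + len(x^{-1}y) +
  len(y^{-1}z), and the hypotheses make the last sum equal to len z. Equality throughout yields both
  conclusions.\<close>

lemma
  assumes "x \<preceq> y" and "y \<preceq> z"
  shows le_trans: "x \<preceq> z"
    and len_quotient_add: "len (inv x \<otimes> y) + len (inv y \<otimes> z) = len (inv x \<otimes> z)"
proof -
  note x = leD(1)[OF assms(1)] and y = leD(2)[OF assms(1)] and z = leD(2)[OF assms(2)]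
  have "len z \<le> len x + len (inv x \<otimes> z)"
    using len_mult_le[of x "inv x \<otimes> z"] x z by (simp add: mult_inv_cancel)
  moreover have "len (inv x \<otimes> z) \<le> len (inv x \<otimes> y) + len (inv y \<otimes> z)"
    using len_mult_le[of "inv x \<otimes> y" "inv y \<otimes> z"] x y z by (simp add: quotient_mult)
  ultimately show "x \<preceq> z" "len (inv x \<otimes> y) + len (inv y \<otimes> z) = len (inv x \<otimes> z)"
    using leD(3)[OF assms(1)] leD(3)[OF assms(2)] x z by (auto simp: prefix_le_def)
qed

lemma strict_trans_le:
  "strict (prefix_le G A) x y \<Longrightarrow> y \<preceq> z \<Longrightarrow> strict (prefix_le G A) x z"
  unfolding strict_def using le_trans[of x y z] le_antisym[of x y] by auto

text \<open>The complement of x^{-1}y in y is y^{-1}xy, a conjugate of x and hence of the same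
  length. Closure of \<open>A\<close> under conjugation enters the order here.\<close>

lemma quotient_le_self:
  assumes "x \<preceq> y"
  shows "inv x \<otimes> y \<preceq> y"
proof -
  note x = leD(1)[OF assms] and y = leD(2)[OF assms]
  have "inv (inv x \<otimes> y) \<otimes> y = inv y \<otimes> x \<otimes> y"
    using x y by (simp add: inv_mult_group)
  then show ?thesis
    using leD(3)[OF assms] x y len_conj[of y x] by (simp add: prefix_le_def)
qed

lemma quotient_le: "x \<preceq> y \<Longrightarrow> y \<preceq> z \<Longrightarrow> inv x \<otimes> y \<preceq> z"
  by (rule le_trans[OF quotient_le_self])

text \<open>Left translation by \<open>x\<close> carries [1, x^{-1}y] into [x, y]: y is the product
  of x, z and a rest whose lengths add up to len y, so subadditivity cannot be strict
  anywhere.\<close>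

lemma mult_le_of_le_quotient:
  assumes "x \<preceq> y" and "z \<preceq> inv x \<otimes> y"
  shows "x \<preceq> x \<otimes> z" and "x \<otimes> z \<preceq> y"
proof -
  note x = leD(1)[OF assms(1)] and y = leD(2)[OF assms(1)] and z = leD(1)[OF assms(2)]
  have q: "inv (x \<otimes> z) \<otimes> y = inv z \<otimes> (inv x \<otimes> y)"
    using x y z by (simp add: inv_mult_group m_assoc)
  have "(x \<otimes> z) \<otimes> (inv z \<otimes> (inv x \<otimes> y)) = y"
    using x y z by (simp add: m_assoc mult_inv_cancel)
  then have "len y \<le> len (x \<otimes> z) + len (inv z \<otimes> (inv x \<otimes> y))"
    using len_mult_le[of "x \<otimes> z" "inv z \<otimes> (inv x \<otimes> y)"] x y z by simp
  moreover have "len (x \<otimes> z) \<le> len x + len z"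
    using len_mult_le x z .
  ultimately have "len (x \<otimes> z) = len x + len z"
    and "len (x \<otimes> z) + len (inv z \<otimes> (inv x \<otimes> y)) = len y"
    using leD(3)[OF assms(1)] leD(3)[OF assms(2)] by auto
  then show "x \<preceq> x \<otimes> z" "x \<otimes> z \<preceq> y"
    using x y z q by (auto simp: prefix_le_def inv_mult_cancel)
qed

section \<open>Atoms, reduced factorizations and covers\<close>

lemma gens_belowD:
  assumes "a \<in> gens_below G A g"
  shows "a \<in> A" and "a \<in> carrier G" and "a \<preceq> g" and "len a = 1"
  using assms gen_closed[of a] len_eq_1_iff[of a] by (simp_all add: gens_below_def)

lemma gens_below_iff: "a \<in> gens_below G A g \<longleftrightarrow> a \<preceq> g \<and> len a = 1"
  unfolding gens_below_def using leD(1)[of a g] len_eq_1_iff[of a] by blast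

lemma gens_below_mono: "g \<preceq> h \<Longrightarrow> gens_below G A g \<subseteq> gens_below G A h"
  using le_trans[of _ g h] by (auto simp: gens_below_def)

lemma Red_one: "Red G A \<one> = {[]}"
  by (auto simp: Red_def)

text \<open>The recursion behind all inductions on words. Forwards, len g \<le> len a + len(a^{-1}g)
  \<le> 1 + length w = len g forces equality in each estimate.\<close>

lemma Red_Cons_iff:
  assumes "g \<in> carrier G"
  shows "a # w \<in> Red G A g \<longleftrightarrow> a \<in> gens_below G A g \<and> w \<in> Red G A (inv a \<otimes> g)"
proof
  assume "a # w \<in> Red G A g"
  from RedD[OF this] have *: "a \<in> A" "set w \<subseteq> A" "a \<otimes> word_prod G w = g" "Suc (length w) = len g"
    by auto
  then have a: "a \<in> carrier G" and w: "word_prod G w \<in> carrier G"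
    by (auto simp: gen_closed word_prod_closed)
  then have q: "inv a \<otimes> g = word_prod G w"
    using *(3) by (auto simp: inv_mult_cancel)
  have "len a \<le> 1"
    using len_word_prod_le[of "[a]"] * a by simp
  moreover have "len g \<le> len a + len (inv a \<otimes> g)"
    using len_mult_le[OF a w] *(3) q by simp
  moreover have "len (inv a \<otimes> g) \<le> length w"
    using len_word_prod_le[OF *(2)] q by simp
  ultimately have "len a = 1" "len (inv a \<otimes> g) = length w" "len a + len (inv a \<otimes> g) = len g"
    using *(4) by linarith+
  then show "a \<in> gens_below G A g \<and> w \<in> Red G A (inv a \<otimes> g)"
    using a assms *(2) q by (auto simp: gens_below_iff prefix_le_def Red_def)
next
  assume *: "a \<in> gens_below G A g \<and> w \<in> Red G A (inv a \<otimes> g)"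
  then have a: "a \<in> A" "a \<in> carrier G" "a \<preceq> g" "len a = 1"
    using gens_belowD by auto
  then show "a # w \<in> Red G A g"
    using * assms leD(3)[OF a(3)] by (auto simp: Red_def mult_inv_cancel)
qed

lemma Red_append:
  assumes "x \<preceq> z" and "z \<preceq> y" and "u \<in> Red G A (inv x \<otimes> z)" and "w \<in> Red G A (inv z \<otimes> y)"
  shows "u @ w \<in> Red G A (inv x \<otimes> y)"
  using RedD[OF assms(3)] RedD[OF assms(4)] len_quotient_add[OF assms(1,2)]
    leD[OF assms(1)] leD[OF assms(2)]
  by (auto simp: Red_def word_prod_append quotient_mult)

lemma ex_gens_below:
  assumes "g \<in> carrier G" and "g \<noteq> \<one>"
  obtains a where "a \<in> gens_below G A g"
proof -
  obtain w where w: "w \<in> Red G A g"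
    using Red_exists assms(1) .
  then obtain a v where "w = a # v"
    using assms by (cases w) (auto simp: Red_def)
  then show ?thesis
    using that w Red_Cons_iff[OF assms(1)] by blast
qed

text \<open>Every atom below \<open>c\<close> is the head of some reduced factorization of
  \<open>c\<close>. Finiteness of \<open>Red G A c\<close> thus ensures that least atoms
  exist.\<close>

lemma finite_gens_below:
  assumes "c \<in> carrier G" and "finite (Red G A c)"
  shows "finite (gens_below G A c)"
proof (rule finite_subset)
  show "gens_below G A c \<subseteq> hd ` Red G A c"
  proof
    fix a assume a: "a \<in> gens_below G A c"
    then have "inv a \<otimes> c \<in> carrier G"
      using assms(1) gens_belowD(2) by auto
    then obtain w where "w \<in> Red G A (inv a \<otimes> c)"
      using Red_exists by blast
    then have "a # w \<in> Red G A c"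
      using a Red_Cons_iff[OF assms(1)] by blast
    then show "a \<in> hd ` Red G A c"
      by force
  qed
qed (use assms in simp)

text \<open>If x < y, then x times an atom of x^{-1}y lies strictly above x and still below y, so in
  a cover it is y. Conversely, a length difference of one leaves no room in between.\<close>

lemma covered_by_iff:
  "covered_by (prefix_le G A) x y \<longleftrightarrow> x \<preceq> y \<and> len (inv x \<otimes> y) = 1"
proof
  assume *: "covered_by (prefix_le G A) x y"
  then have le: "x \<preceq> y" and "x \<noteq> y"
    by (auto simp: covered_by_def strict_def)
  note x = leD(1)[OF le] and y = leD(2)[OF le]
  have "inv x \<otimes> y \<noteq> \<one>"
    using mult_inv_cancel[of x y] x y \<open>x \<noteq> y\<close> by auto
  then obtain a where a: "a \<in> gens_below G A (inv x \<otimes> y)"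
    using ex_gens_below x y by (metis inv_closed m_closed)
  then have xa: "x \<preceq> x \<otimes> a" "x \<otimes> a \<preceq> y" and "a \<in> carrier G"
    using mult_le_of_le_quotient[OF le] gens_belowD by auto
  then have la: "len (x \<otimes> a) = len x + 1"
    using x gens_belowD(4)[OF a] by (simp add: le_mult_iff)
  then have "x \<otimes> a = y"
    using * xa by (auto simp: covered_by_def strict_def)
  then show "x \<preceq> y \<and> len (inv x \<otimes> y) = 1"
    using le la leD(3)[OF le] by simp
next
  assume *: "x \<preceq> y \<and> len (inv x \<otimes> y) = 1"
  then have "len y = len x + 1"
    using leD(3)[of x y] by simp
  then have "x \<noteq> y" "\<not> (\<exists>z. strict (prefix_le G A) x z \<and> strict (prefix_le G A) z y)"
    using strict_len_less by (auto dest!: strict_len_less)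
  then show "covered_by (prefix_le G A) x y"
    using * by (simp add: covered_by_def strict_def)
qed

lemma fact_poset_iff:
  assumes "c \<in> carrier G"
  shows "g \<in> fact_poset G A c \<longleftrightarrow> g \<preceq> c"
  using leD(1)[of g c] one_le by (auto simp: fact_poset_def interval_def)

lemma interval_fact_poset:
  assumes "y \<preceq> c"
  shows "z \<in> interval (fact_poset G A c) (prefix_le G A) x y \<longleftrightarrow> x \<preceq> z \<and> z \<preceq> y"
  using fact_poset_iff[OF leD(2)[OF assms]] le_trans[of z y c] assms by (auto simp: interval_def)

section \<open>Maximal chains and reduced factorizations\<close>

lemma partial_products_Nil: "x \<in> carrier G \<Longrightarrow> partial_products G x [] = [x]"
  by (simp add: partial_products_def)

lemma partial_products_Cons:
  assumes "x \<in> carrier G" and "set (a # w) \<subseteq> A"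
  shows "partial_products G x (a # w) = x # partial_products G (x \<otimes> a) w"
proof -
  \<comment> \<open>Index 0 contributes \<open>x\<close>; the other indices are shifted by one, so
    that their prefixes all begin with \<open>a\<close>.\<close>
  have "map (\<lambda>k. x \<otimes> word_prod G (take k (a # w))) [0..<Suc (Suc (length w))] =
    x # map (\<lambda>k. x \<otimes> word_prod G (take (Suc k) (a # w))) [0..<Suc (length w)]"
    using assms(1) by (subst upt_conv_Cons) (simp_all add: map_Suc_upt[symmetric] del: upt_Suc)
  moreover have "x \<otimes> (a \<otimes> word_prod G (take k w)) = x \<otimes> a \<otimes> word_prod G (take k w)" for k
  proof -
    have "set (take k w) \<subseteq> A" "a \<in> carrier G"
      using assms(2) set_take_subset[of k w] gen_closed by auto
    then show ?thesis
      using assms(1) word_prod_closed by (simp add: m_assoc)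
  qed
  ultimately show ?thesis
    by (simp add: partial_products_def del: upt_Suc)
qed

lemma label_seq_Cons_Cons:
  "label_seq lam (x # y # xs) = lam x y # label_seq lam (y # xs)"
  by (simp add: label_seq_def)

text \<open>Neighbours in the walk differ by right multiplication with one letter, which the natural
  label reads off. In particular a word can be recovered from its walk.\<close>

lemma label_seq_partial_products:
  assumes "x \<in> carrier G" and "set w \<subseteq> A"
  shows "label_seq (natural_label G) (partial_products G x w) = w"
  using assms
proof (induction w arbitrary: x)
  case Nil
  then show ?case
    by (simp add: partial_products_Nil label_seq_def)
next
  case (Cons a w)
  then have a: "x \<otimes> a \<in> carrier G" "a \<in> carrier G" "set w \<subseteq> A"
    by (auto simp: gen_closed)
  obtain ys where ys: "partial_products G (x \<otimes> a) w = (x \<otimes> a) # ys"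
    using a by (cases w) (auto simp: partial_products_Nil partial_products_Cons)
  show ?case
    using Cons.IH[OF a(1,3)] Cons.prems a
    by (simp add: partial_products_Cons ys label_seq_Cons_Cons natural_label_def inv_mult_cancel)
qed

lemma set_partial_products_append:
  assumes "x \<in> carrier G" and "set u \<subseteq> A" and "set w \<subseteq> A"
  shows "set (partial_products G (x \<otimes> word_prod G u) w) \<subseteq> set (partial_products G x (u @ w))"
  using assms
proof (induction u arbitrary: x)
  case Nil
  then show ?case by simp
next
  case (Cons a u)
  then have "a \<in> carrier G" "word_prod G u \<in> carrier G"
    by (auto simp: gen_closed word_prod_closed)
  then show ?case
    using Cons.IH[of "x \<otimes> a"] Cons.prems by (auto simp: partial_products_Cons m_assoc)
qed

text \<open>The last conjunct, that every length between those of \<open>x\<close> and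
  \<open>y\<close> occurs, is what later makes the chain maximal.\<close>

lemma partial_products_Red:
  assumes "x \<preceq> y" and "w \<in> Red G A (inv x \<otimes> y)"
  shows "sorted_wrt (strict (prefix_le G A)) (partial_products G x w) \<and>
    (\<forall>z\<in>set (partial_products G x w). x \<preceq> z \<and> z \<preceq> y) \<and>
    len ` set (partial_products G x w) = {len x..len y}"
  using assms
proof (induction w arbitrary: x)
  case Nil
  then have "len (inv x \<otimes> y) = 0"
    using RedD(3) by fastforce
  then have "x = y"
    using Nil.prems(1) leD(3)[of x y] le_len_eq[of x y] by simp
  then show ?case
    using leD[OF Nil.prems(1)] by (simp add: partial_products_Nil le_refl)
next
  case (Cons a w)
  note x = leD(1)[OF Cons.prems(1)] and y = leD(2)[OF Cons.prems(1)]
  have a: "a \<in> gens_below G A (inv x \<otimes> y)" and w: "w \<in> Red G A (inv a \<otimes> (inv x \<otimes> y))"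
    using Cons.prems(2) x y Red_Cons_iff by auto
  note aD = gens_belowD[OF a]
  have xa: "x \<preceq> x \<otimes> a" "x \<otimes> a \<preceq> y"
    using mult_le_of_le_quotient[OF Cons.prems(1) aD(3)] .
  have l: "len (x \<otimes> a) = Suc (len x)"
    using xa(1) x aD by (simp add: le_mult_iff)
  have w': "w \<in> Red G A (inv (x \<otimes> a) \<otimes> y)"
    using w x y aD by (simp add: inv_mult_group m_assoc)
  note IH = Cons.IH[OF xa(2) w']
  have pp: "partial_products G x (a # w) = x # partial_products G (x \<otimes> a) w"
    using RedD(1)[OF Cons.prems(2)] x by (simp add: partial_products_Cons)
  have "strict (prefix_le G A) x (x \<otimes> a)"
    using xa l by (auto simp: strict_def)
  then have "\<forall>z\<in>set (partial_products G (x \<otimes> a) w). strict (prefix_le G A) x z"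
    using IH strict_trans_le by blast
  moreover have "len x \<le> len y"
    using leD(3)[OF Cons.prems(1)] by simp
  moreover have "len ` set (partial_products G x (a # w)) = insert (len x) {Suc (len x)..len y}"
    using IH by (simp add: pp l)
  ultimately show ?case
    using IH Cons.prems(1) le_refl[OF x]
    by (auto simp: pp strict_def atLeastAtMost_insertL)
qed

text \<open>The gap between \<open>x\<close> and the first entry is filled by any reduced word of
  their quotient. The rest is filled by induction, and the concatenation is again reduced because
  lengths of quotients add up.\<close>

lemma sorted_refines_to_Red:
  assumes "x \<preceq> y" and "sorted_wrt (strict (prefix_le G A)) xs"
    and "\<And>z. z \<in> set xs \<Longrightarrow> x \<preceq> z \<and> z \<preceq> y"
  shows "\<exists>w\<in>Red G A (inv x \<otimes> y). set xs \<subseteq> set (partial_products G x w)"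
  using assms
proof (induction xs arbitrary: x)
  case Nil
  then show ?case
    using Red_exists[of "inv x \<otimes> y"] leD[OF Nil.prems(1)] by auto
next
  case (Cons z zs)
  then have xz: "x \<preceq> z" "z \<preceq> y"
    by auto
  have "z \<preceq> v \<and> v \<preceq> y" if "v \<in> set zs" for v
    using Cons.prems that by (auto simp: strict_def)
  then obtain w where w: "w \<in> Red G A (inv z \<otimes> y)" "set zs \<subseteq> set (partial_products G z w)"
    using Cons.IH[of z] Cons.prems xz by auto
  note x = leD(1)[OF xz(1)] and z = leD(2)[OF xz(1)]
  obtain u where u: "u \<in> Red G A (inv x \<otimes> z)"
    using Red_exists[OF m_closed[OF inv_closed[OF x] z]] .
  have "x \<otimes> word_prod G u = z"
    using RedD(2)[OF u] x z by (simp add: mult_inv_cancel)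
  then have "set (partial_products G z w) \<subseteq> set (partial_products G x (u @ w))"
    using set_partial_products_append[OF x RedD(1)[OF u] RedD(1)[OF w(1)]] by simp
  moreover have "z \<in> set (partial_products G z w)"
    using z RedD(1)[OF w(1)]
    by (cases w) (auto simp: partial_products_Nil partial_products_Cons)
  ultimately show ?case
    using Red_append[OF xz u w(1)] w(2) by (intro bexI[of _ "u @ w"]) auto
qed

lemma sorted_strict_comparable:
  assumes "sorted_wrt (strict (prefix_le G A)) xs" and "u \<in> set xs" and "v \<in> set xs"
  shows "(strict (prefix_le G A))\<^sup>=\<^sup>= u v \<or> (strict (prefix_le G A))\<^sup>=\<^sup>= v u"
  using assms by (induction xs) auto

lemma maximal_chains_eq:
  assumes "x \<preceq> y" and I: "\<And>z. z \<in> I \<longleftrightarrow> x \<preceq> z \<and> z \<preceq> y"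
  shows "maximal_chains I (prefix_le G A) = partial_products G x ` Red G A (inv x \<otimes> y)"
proof (intro equalityI subsetI)
  let ?S = "strict (prefix_le G A)"
  have chain: "pred_on.chain I ?S (set (partial_products G x w))"
    if w: "w \<in> Red G A (inv x \<otimes> y)" for w
    using partial_products_Red[OF assms(1) w] sorted_strict_comparable I
    unfolding pred_on.chain_def by blast
  {
    fix xs assume "xs \<in> maximal_chains I (prefix_le G A)"
    then have srt: "sorted_wrt ?S xs" and mc: "pred_on.maxchain I ?S (set xs)"
      by (auto simp: maximal_chains_def)
    then have "set xs \<subseteq> I"
      by (auto simp: pred_on.maxchain_def pred_on.chain_def)
    \<comment> \<open>A maximal chain equals the word chain that refines it, first as a set and
      then, being sorted, as a list.\<close>
    then obtain w where w: "w \<in> Red G A (inv x \<otimes> y)" "set xs \<subseteq> set (partial_products G x w)"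
      using sorted_refines_to_Red[OF assms(1) srt] I by blast
    then have "set xs = set (partial_products G x w)"
      using mc chain[OF w(1)] by (auto simp: pred_on.maxchain_def)
    moreover have "\<not> ?S v u" if "?S u v" for u v
      using that le_antisym by (auto simp: strict_def)
    ultimately have "xs = partial_products G x w"
      using sorted_wrt_strict_set_unique[of ?S] srt partial_products_Red[OF assms(1) w(1)] by blast
    then show "xs \<in> partial_products G x ` Red G A (inv x \<otimes> y)"
      using w(1) by blast
  next
    fix xs assume "xs \<in> partial_products G x ` Red G A (inv x \<otimes> y)"
    then obtain w where w: "w \<in> Red G A (inv x \<otimes> y)" and xs: "xs = partial_products G x w"
      by blast
    note pp = partial_products_Red[OF assms(1) w, folded xs]
    have "\<not> set xs \<subset> C" if C: "pred_on.chain I ?S C" for C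
    proof
      assume sub: "set xs \<subset> C"
      then obtain z where z: "z \<in> C" "z \<notin> set xs"
        by blast
      then have "x \<preceq> z" "z \<preceq> y"
        using C I by (auto simp: pred_on.chain_def)
      \<comment> \<open>An additional element \<open>z\<close> would be comparable to the chain
        element of its own length, hence equal to it.\<close>
      then have "len z \<in> len ` set xs"
        using pp leD(3)[of x z] leD(3)[of z y] by simp
      then obtain p where p: "p \<in> set xs" "len p = len z"
        by force
      then have "p = z \<or> p \<preceq> z \<or> z \<preceq> p"
        using C z sub unfolding pred_on.chain_def strict_def by blast
      then show False
        using le_len_eq p z(2) by (metis order_refl)
    qed
    then show "xs \<in> maximal_chains I (prefix_le G A)"
      using pp chain[OF w] by (auto simp: maximal_chains_def pred_on.maxchain_def xs)
  }
qed

section \<open>The EL condition in terms of reduced words\<close>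

lemma EL_condition_iff_rising_first:
  assumes "x \<preceq> y" and "\<And>z. z \<in> I \<longleftrightarrow> x \<preceq> z \<and> z \<preceq> y"
  shows "(let M = maximal_chains I (prefix_le G A) in
      (\<exists>!xs. xs \<in> M \<and> rising r (label_seq (natural_label G) xs)) \<and>
      (\<forall>xs\<in>M. rising r (label_seq (natural_label G) xs) \<longrightarrow>
        (\<forall>ys\<in>M. ys \<noteq> xs \<longrightarrow>
          (label_seq (natural_label G) xs, label_seq (natural_label G) ys) \<in> lexord (r - Id))))
    \<longleftrightarrow> rising_first G A r (inv x \<otimes> y)" (is "?L \<longleftrightarrow> ?R")
proof -
  let ?M = "maximal_chains I (prefix_le G A)" and ?lab = "label_seq (natural_label G)"
  let ?p = "partial_products G x" and ?W = "Red G A (inv x \<otimes> y)"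
  have M: "?M = ?p ` ?W"
    using maximal_chains_eq assms .
  have lab: "?lab (?p w) = w" if "w \<in> ?W" for w
    using label_seq_partial_products leD(1)[OF assms(1)] RedD(1)[OF that] .
  \<comment> \<open>Reading labels inverts \<open>?p\<close>, so chains and words correspond
    bijectively and both halves of the condition transfer.\<close>
  have inj: "inj_on ?p ?W"
    using lab by (rule inj_on_inverseI)
  show ?thesis
  proof
    assume L: ?L
    then obtain xs0 where xs0: "xs0 \<in> ?M" "rising r (?lab xs0)"
      and uniq0: "\<And>xs. xs \<in> ?M \<Longrightarrow> rising r (?lab xs) \<Longrightarrow> xs = xs0"
      unfolding Let_def by metis
    obtain w where w: "w \<in> ?W" "rising r w"
      and uniq: "\<And>xs. xs \<in> ?M \<Longrightarrow> rising r (?lab xs) \<Longrightarrow> xs = ?p w"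
    proof -
      obtain w where "w \<in> ?W" "xs0 = ?p w"
        using xs0(1) M by blast
      then show thesis
        using that[of w] xs0(2) uniq0 lab by simp
    qed
    have "\<not> rising r v \<and> (w, v) \<in> lexord (r - Id)" if v: "v \<in> ?W" "v \<noteq> w" for v
    proof -
      have ne: "?p v \<noteq> ?p w"
        using inj v w(1) by (auto dest: inj_onD)
      have "\<not> rising r v"
        using uniq[of "?p v"] ne v(1) lab M by auto
      moreover have "(?lab (?p w), ?lab (?p v)) \<in> lexord (r - Id)"
      proof -
        have "?p w \<in> ?M" "?p v \<in> ?M" "rising r (?lab (?p w))"
          using M v(1) w lab by auto
        then show ?thesis
          using L ne unfolding Let_def by metis
      qed
      ultimately show ?thesis
        using lab v(1) w(1) by simp
    qed
    then show ?R
      using w by (auto simp: rising_first_def)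
  next
    assume ?R
    then obtain w where w: "w \<in> ?W" "rising r w"
      and first: "\<And>v. v \<in> ?W \<Longrightarrow> v \<noteq> w \<Longrightarrow> \<not> rising r v \<and> (w, v) \<in> lexord (r - Id)"
      unfolding rising_first_def by blast
    have only: "v = w" if "v \<in> ?W" "rising r v" for v
      using first that by blast
    have "\<exists>!xs. xs \<in> ?M \<and> rising r (?lab xs)"
    proof (rule ex1I[of _ "?p w"])
      show "?p w \<in> ?M \<and> rising r (?lab (?p w))"
        using w lab M by auto
      show "xs = ?p w" if "xs \<in> ?M \<and> rising r (?lab xs)" for xs
        using that only lab M by auto
    qed
    moreover have "(?lab xs, ?lab ys) \<in> lexord (r - Id)"
      if "xs \<in> ?M" "rising r (?lab xs)" "ys \<in> ?M" "ys \<noteq> xs" for xs ys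
    proof -
      have "xs \<in> ?p ` ?W" "ys \<in> ?p ` ?W"
        using that M by simp_all
      then obtain u v where uv: "u \<in> ?W" "xs = ?p u" "v \<in> ?W" "ys = ?p v"
        by (elim imageE)
      then have "u = w" "v \<noteq> w"
        using only that lab by auto
      then show ?thesis
        using uv first lab by simp
    qed
    ultimately show ?L
      by (simp add: Let_def)
  qed
qed

lemma EL_labeling_iff_rising_first:
  assumes "c \<in> carrier G"
  shows "EL_labeling (fact_poset G A c) (prefix_le G A) (natural_label G) r \<longleftrightarrow>
    (\<forall>g. g \<preceq> c \<longrightarrow> rising_first G A r g)"
proof -
  have "EL_labeling (fact_poset G A c) (prefix_le G A) (natural_label G) r \<longleftrightarrow>
    (\<forall>x y. x \<preceq> y \<and> y \<preceq> c \<longrightarrow> rising_first G A r (inv x \<otimes> y))"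
  proof -
    have pos: "x \<in> fact_poset G A c" "y \<in> fact_poset G A c" if "x \<preceq> y" "y \<preceq> c" for x y
      using fact_poset_iff[OF assms] le_trans[OF that] that(2) by simp_all
    note iff = EL_condition_iff_rising_first[OF _ interval_fact_poset]
    show ?thesis
    proof (intro iffI allI impI)
      fix x y
      assume EL: "EL_labeling (fact_poset G A c) (prefix_le G A) (natural_label G) r"
        and "x \<preceq> y \<and> y \<preceq> c"
      then have xy: "x \<preceq> y" "y \<preceq> c"
        by auto
      show "rising_first G A r (inv x \<otimes> y)"
        by (rule iffD1[OF iff[OF xy]], rule EL[unfolded EL_labeling_def, rule_format])
          (use xy pos in simp_all)
    next
      assume "\<forall>x y. x \<preceq> y \<and> y \<preceq> c \<longrightarrow> rising_first G A r (inv x \<otimes> y)"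
      then show "EL_labeling (fact_poset G A c) (prefix_le G A) (natural_label G) r"
        unfolding EL_labeling_def
        by (intro ballI impI, intro iffD2[OF iff]) (simp_all add: fact_poset_iff[OF assms])
    qed
  qed
  \<comment> \<open>The choice x = 1 gives one direction; for the other, x^{-1}y is itself below
    \<open>c\<close>.\<close>
  also have "\<dots> \<longleftrightarrow> (\<forall>g. g \<preceq> c \<longrightarrow> rising_first G A r g)"
  proof
    assume *: "\<forall>x y. x \<preceq> y \<and> y \<preceq> c \<longrightarrow> rising_first G A r (inv x \<otimes> y)"
    show "\<forall>g. g \<preceq> c \<longrightarrow> rising_first G A r g"
    proof (intro allI impI)
      fix g assume g: "g \<preceq> c"
      show "rising_first G A r g"
        using *[rule_format, of \<one> g] g one_le leD(1)[OF g] by simp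
    qed
  qed (use quotient_le in blast)
  finally show ?thesis .
qed

section \<open>Compatible orders and well-coveredness\<close>

text \<open>The complement of \<open>a\<close> in \<open>h\<close> has length one, so it is a
  generator and the only possible second letter.\<close>

lemma Red_pair_iff:
  assumes "a \<preceq> h" and "len a = 1" and "len h = 2"
  shows "[a, b] \<in> Red G A h \<longleftrightarrow> b = inv a \<otimes> h"
proof -
  note a = leD(1)[OF assms(1)] and h = leD(2)[OF assms(1)]
  have q: "inv a \<otimes> h \<in> carrier G" "len (inv a \<otimes> h) = 1"
    using a h leD(3)[OF assms(1)] assms by auto
  have qA: "inv a \<otimes> h \<in> A"
    using len_eq_1_iff[OF q(1)] q(2) by simp
  have "[a, b] \<in> Red G A h \<longleftrightarrow> [b] \<in> Red G A (inv a \<otimes> h)"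
    using Red_Cons_iff[OF h] assms by (simp add: gens_below_iff)
  also have "\<dots> \<longleftrightarrow> b = inv a \<otimes> h"
    using q qA by (auto simp: Red_def gen_closed)
  finally show ?thesis .
qed

text \<open>Passes from a reduced word of \<open>g\<close> to the element of length two spelled by
  its first two letters. The second letter is an atom of \<open>g\<close> too, because a^{-1}g lies
  below \<open>g\<close>.\<close>

lemma Red_Cons_Cons_take2:
  assumes "g \<in> carrier G" and "a # b # w \<in> Red G A g"
  shows "a \<preceq> a \<otimes> b" and "a \<otimes> b \<preceq> g" and "len (a \<otimes> b) = 2" and "len a = 1" and "len b = 1"
    and "[a, b] \<in> Red G A (a \<otimes> b)" and "b \<in> gens_below G A (inv a \<otimes> g)"
    and "b \<in> gens_below G A g" and "covered_by (prefix_le G A) a (a \<otimes> b)"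
proof -
  have a: "a \<in> gens_below G A g" and bw: "b # w \<in> Red G A (inv a \<otimes> g)"
    using assms Red_Cons_iff by auto
  note aD = gens_belowD[OF a]
  show b: "b \<in> gens_below G A (inv a \<otimes> g)"
    using bw Red_Cons_iff aD assms(1) by simp
  note bD = gens_belowD[OF b]
  show ab: "a \<preceq> a \<otimes> b" "a \<otimes> b \<preceq> g"
    using mult_le_of_le_quotient[OF aD(3) bD(3)] .
  show "b \<in> gens_below G A g"
    using b gens_below_mono quotient_le_self[OF aD(3)] by blast
  show l: "len (a \<otimes> b) = 2" and "len a = 1" "len b = 1"
    using ab(1) aD bD by (simp_all add: le_mult_iff)
  show "[a, b] \<in> Red G A (a \<otimes> b)"
    using Red_pair_iff[OF ab(1) aD(4) l] aD bD by (simp add: inv_mult_cancel)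
  show "covered_by (prefix_le G A) a (a \<otimes> b)"
    using ab(1) aD bD by (simp add: covered_by_iff inv_mult_cancel)
qed

lemma Red_length_2E:
  assumes "w \<in> Red G A g" and "len g = 2"
  obtains a b where "w = [a, b]"
  using RedD(3)[OF assms(1)] assms(2) by (auto simp: numeral_2_eq_2 length_Suc_conv)

section \<open>The two implications for a fixed linear order on the atoms of
  \<open>c\<close>\<close>

context
  fixes c :: 'a and r :: "('a \<times> 'a) set"
  assumes lin: "linear_order_on (gens_below G A c) r"
begin

lemma order_total: "a \<in> gens_below G A c \<Longrightarrow> b \<in> gens_below G A c \<Longrightarrow> (a, b) \<in> r \<or> (b, a) \<in> r"
  using lin unfolding linear_order_on_def partial_order_on_def preorder_on_def
      total_on_def refl_on_def by metis

lemma order_antisym: "(a, b) \<in> r \<Longrightarrow> (b, a) \<in> r \<Longrightarrow> a = b"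
  using lin unfolding linear_order_on_def partial_order_on_def antisym_def by blast

lemma order_trans: "(a, b) \<in> r \<Longrightarrow> (b, d) \<in> r \<Longrightarrow> (a, d) \<in> r"
  using lin unfolding linear_order_on_def partial_order_on_def preorder_on_def trans_def by blast

lemma compatible_if_rising_first:
  assumes "\<And>g. g \<preceq> c \<Longrightarrow> rising_first G A r g"
  shows "compatible G A c r"
  unfolding compatible_def
proof (intro allI impI)
  fix g assume g: "g \<preceq> c \<and> len g = 2"
  then obtain w where w: "w \<in> Red G A g" "rising r w"
    and uniq: "\<And>v. v \<in> Red G A g \<Longrightarrow> rising r v \<Longrightarrow> v = w"
    using assms unfolding rising_first_def by blast
  obtain a b where ab: "w = [a, b]"
    using Red_length_2E w(1) g by blast
  show "\<exists>!p. [fst p, snd p] \<in> Red G A g \<and> p \<in> r"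
  proof (rule ex1I[of _ "(a, b)"])
    show "[fst (a, b), snd (a, b)] \<in> Red G A g \<and> (a, b) \<in> r"
      using w ab by (simp add: rising_def)
    show "p = (a, b)" if "[fst p, snd p] \<in> Red G A g \<and> p \<in> r" for p
      using uniq[of "[fst p, snd p]"] that ab by (cases p) (simp add: rising_def)
  qed
qed

lemma totally_well_covered_if_rising_first:
  assumes "\<And>g. g \<preceq> c \<Longrightarrow> rising_first G A r g"
  shows "totally_well_covered G A c r"
  unfolding totally_well_covered_def well_covered_def
proof (intro ballI)
  fix g a assume "g \<in> fact_poset G A c" and a: "a \<in> gens_below G A g"
  then have g: "g \<preceq> c"
    by (auto simp: fact_poset_def interval_def)
  note gc = leD(1)[OF g] and aD = gens_belowD[OF a]
  have sub: "gens_below G A g \<subseteq> gens_below G A c"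
    using gens_below_mono g .
  let ?r = "Restr r (gens_below G A g)"
  show "F_set G A ?r a g = {} \<longleftrightarrow> (\<forall>b\<in>gens_below G A g. (a, b) \<in> ?r)"
  proof
    assume "\<forall>b\<in>gens_below G A g. (a, b) \<in> ?r"
    then show "F_set G A ?r a g = {}"
      using order_antisym unfolding F_set_def by blast
  next
    assume F: "F_set G A ?r a g = {}"
    have "inv a \<otimes> g \<preceq> c"
      using quotient_le[OF aD(3) g] .
    then obtain w where w: "w \<in> Red G A (inv a \<otimes> g)" "rising r w"
      using assms unfolding rising_first_def by blast
    have aw: "a # w \<in> Red G A g"
      using w a gc Red_Cons_iff by blast
    have "rising r (a # w)"
    proof (cases w)
      case Nil
      then show ?thesis by (simp add: rising_def)
    next
      case (Cons b w')
      note ab = Red_Cons_Cons_take2[OF gc aw[unfolded Cons]]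
      have "(a, b) \<in> r"
      proof (rule ccontr)
        assume nab: "(a, b) \<notin> r"
        \<comment> \<open>At a descent \<open>[a, b]\<close>, the rising word \<open>[p, q]\<close>
          of the same product is lexicographically smaller.\<close>
        obtain v where v: "v \<in> Red G A (a \<otimes> b)" "rising r v"
          and first: "\<And>u. u \<in> Red G A (a \<otimes> b) \<Longrightarrow> u \<noteq> v \<Longrightarrow> (v, u) \<in> lexord (r - Id)"
          using assms[OF le_trans[OF ab(2) g]] unfolding rising_first_def by blast
        obtain p q where pq: "v = [p, q]"
          using Red_length_2E v(1) ab(3) by blast
        have "v \<noteq> [a, b]"
          using v(2) nab by (auto simp: rising_def)
        then have lex: "([p, q], [a, b]) \<in> lexord (r - Id)"
          using first[OF ab(6)] pq by metis
        have p: "p \<in> gens_below G A (a \<otimes> b)"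
          using v(1) pq Red_Cons_iff leD(1)[OF ab(2)] by blast
        note pD = gens_belowD[OF p]
        \<comment> \<open>Equal first letters would force equal second letters, making
          \<open>[a, b]\<close> rising.\<close>
        have "p \<noteq> a"
          using v pq ab Red_pair_iff nab by (auto simp: rising_def)
        then have "(p, a) \<in> r - Id"
          using lex by auto
        moreover have pg: "p \<in> gens_below G A g"
          using p gens_below_mono[OF ab(2)] by blast
        moreover have "covered_by (prefix_le G A) p (a \<otimes> b)"
          using leD(3)[OF pD(3)] pD ab(3) by (simp add: covered_by_iff)
        ultimately have "a \<otimes> b \<in> F_set G A ?r a g"
          using ab(2,9) a unfolding F_set_def by blast
        then show False
          using F by simp
      qed
      then show ?thesis
        using w(2) Cons by (simp add: rising_Cons_Cons)
    qed
    then have first: "(a # w, v) \<in> lexord (r - Id)" if "v \<in> Red G A g" "v \<noteq> a # w" for v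
      using assms[OF g] aw that unfolding rising_first_def by metis
    show "\<forall>b\<in>gens_below G A g. (a, b) \<in> ?r"
    proof
      \<comment> \<open>Any atom \<open>b\<close> starts some reduced word of \<open>g\<close>, and
        comparing it with the lexicographically first word \<open>a # w\<close> compares
        \<open>a\<close> with \<open>b\<close>.\<close>
      fix b assume b: "b \<in> gens_below G A g"
      note bD = gens_belowD[OF b]
      obtain v where "v \<in> Red G A (inv b \<otimes> g)"
        using Red_exists[OF m_closed[OF inv_closed[OF bD(2)] gc]] .
      then have "b # v \<in> Red G A g"
        using b gc Red_Cons_iff by blast
      then have "(a, b) \<in> r \<or> a = b"
        using first[of "b # v"] by auto
      then show "(a, b) \<in> ?r"
        using a b sub order_total[of a a] by auto
    qed
  qed
qed

text \<open>Each atom \<open>b'\<close> begins some reduced word, and the rising word, being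
  lexicographically first, cannot have a later first letter.\<close>

lemma rising_starts_with_least:
  assumes "h \<preceq> c" and "rising_first G A r h" and "b # v \<in> Red G A h" and "rising r (b # v)"
    and "b' \<in> gens_below G A h"
  shows "(b, b') \<in> r"
proof (cases "b' = b")
  case True
  then show ?thesis
    using order_total assms(5) gens_below_mono[OF assms(1)] by blast
next
  case False
  note h = leD(1)[OF assms(1)]
  obtain u where "u \<in> Red G A (inv b' \<otimes> h)"
    using Red_exists[OF m_closed[OF inv_closed[OF gens_belowD(2)[OF assms(5)]] h]] .
  then have "b' # u \<in> Red G A h"
    using assms(5) h Red_Cons_iff by blast
  then have "(b # v, b' # u) \<in> lexord (r - Id)"
    using assms(2-4) False unfolding rising_first_def by (metis list.inject)
  then show ?thesis
    using False by auto
qed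

lemma rising_first_if_compatible:
  assumes fin: "finite (Red G A c)" and cpt: "compatible G A c r"
    and wc: "totally_well_covered G A c r"
    and "g \<preceq> c"
  shows "rising_first G A r g"
  using \<open>g \<preceq> c\<close>
proof (induction "len g" arbitrary: g rule: less_induct)
  case less
  note g = less.prems and gc = leD(1)[OF less.prems]
  have least: "\<exists>m\<in>gens_below G A h. \<forall>b\<in>gens_below G A h. (m, b) \<in> r"
    if "h \<preceq> c" "h \<noteq> \<one>" for h
  proof -
    have "gens_below G A h \<subseteq> gens_below G A c" "finite (gens_below G A c)"
      using gens_below_mono that(1) finite_gens_below[OF _ fin] leD(2)[OF g] by auto
    moreover have "gens_below G A h \<noteq> {}"
      using ex_gens_below that leD(1) by blast
    ultimately show ?thesis
      using linear_order_on_finite_has_least[OF lin] by (metis finite_subset)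
  qed
  \<comment> \<open>Removing an atom lowers the length by one and stays below \<open>c\<close>, so
    the induction hypothesis applies.\<close>
  have quot: "rising_first G A r (inv a \<otimes> g)" "inv a \<otimes> g \<preceq> c" if "a \<in> gens_below G A g" for a
    using less.hyps[of "inv a \<otimes> g"] quotient_le[OF gens_belowD(3)[OF that] g]
      leD(3)[OF gens_belowD(3)[OF that]] gens_belowD(4)[OF that] by auto
  show ?case
  proof (cases "g = \<one>")
    case True
    then show ?thesis
      by (simp add: rising_first_def Red_one rising_def)
  next
    case False
    obtain a where a: "a \<in> gens_below G A g" and amin: "\<And>b. b \<in> gens_below G A g \<Longrightarrow> (a, b) \<in> r"
      using least[OF g False] by blast
    obtain w where w: "w \<in> Red G A (inv a \<otimes> g)" "rising r w"
      and first: "\<And>v. v \<in> Red G A (inv a \<otimes> g) \<Longrightarrow> v \<noteq> w \<Longrightarrow>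
        \<not> rising r v \<and> (w, v) \<in> lexord (r - Id)"
      using quot(1)[OF a] unfolding rising_first_def by blast
    have aw: "a # w \<in> Red G A g"
      using Red_Cons_iff a w(1) gc by blast
    have raw: "rising r (a # w)"
    proof (cases w)
      case Nil
      then show ?thesis by (simp add: rising_def)
    next
      case (Cons b w')
      then have "b \<in> gens_below G A g"
        using Red_Cons_Cons_take2(8)[OF gc] aw by blast
      then show ?thesis
        using amin w(2) Cons by (simp add: rising_Cons_Cons)
    qed
    have "\<not> rising r v \<and> (a # w, v) \<in> lexord (r - Id)"
      if v: "v \<in> Red G A g" "v \<noteq> a # w" for v
    proof -
      have "v \<noteq> []"
        using v(1) False by (auto simp: Red_def)
      then obtain b u where bu: "v = b # u"
        by (cases v) auto
      have b: "b \<in> gens_below G A g" and u: "u \<in> Red G A (inv b \<otimes> g)"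
        using v(1) bu Red_Cons_iff gc by auto
      note bD = gens_belowD[OF b]
      show ?thesis
      proof (cases "b = a")
        case True
        then show ?thesis
          using first[of u] u v(2) bu rising_ConsD[of r b u] by auto
      next
        case False
        have "(a, b) \<in> r - Id"
          using amin[OF b] False by auto
        then have lex: "(a # w, v) \<in> lexord (r - Id)"
          using bu by simp
        have "(b, a) \<notin> r"
          using amin[OF b] order_antisym False by blast
        moreover have "g \<in> fact_poset G A c"
          using fact_poset_iff leD(2)[OF g] g by blast
        \<comment> \<open>Since \<open>b\<close> is not the least atom of \<open>g\<close>,
          well-coveredness supplies \<open>h\<close> covering both \<open>b\<close> and an earlier
          atom \<open>a'\<close>.\<close>
        ultimately have "F_set G A (Restr r (gens_below G A g)) b g \<noteq> {}"
          using wc a b unfolding totally_well_covered_def well_covered_def by blast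
        then obtain h a' where h: "covered_by (prefix_le G A) b h" "h \<preceq> g"
          and a': "(a', b) \<in> r" "a' \<noteq> b" "covered_by (prefix_le G A) a' h" "a' \<in> gens_below G A g"
          unfolding F_set_def by auto
        have bh: "b \<preceq> h" "len (inv b \<otimes> h) = 1" and a'h: "a' \<preceq> h"
          using h(1) a'(3) by (auto simp: covered_by_iff)
        have lh: "len h = 2"
          using leD(3)[OF bh(1)] bD(4) bh(2) by simp
        have hc: "h \<preceq> c"
          using le_trans h(2) g .
        define b' where "b' = inv b \<otimes> h"
        have bb': "[b, b'] \<in> Red G A h"
          using Red_pair_iff bh(1) bD(4) lh by (simp add: b'_def)
        have "\<not> rising r v"
        proof
          assume rv: "rising r v"
          have lbg: "len (inv b \<otimes> h) + len (inv h \<otimes> g) = len (inv b \<otimes> g)"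
            using len_quotient_add[OF bh(1) h(2)] .
          \<comment> \<open>The complement of \<open>b'\<close> in b^{-1}g is h^{-1}g, so
            \<open>b'\<close> is an atom of b^{-1}g and can be compared with the letter
            \<open>d\<close> after \<open>b\<close>.\<close>
          have "inv (inv b \<otimes> h) \<otimes> (inv b \<otimes> g) = inv h \<otimes> g"
            using bD(2) leD[OF h(2)] by (simp add: inv_mult_group m_assoc mult_inv_cancel)
          then have b'g: "b' \<in> gens_below G A (inv b \<otimes> g)"
            using lbg bh(2) bD(2) leD[OF h(2)] by (simp add: gens_below_iff prefix_le_def b'_def)
          have "u \<noteq> []"
            using bh(2) lbg RedD(3)[OF u] by auto
          then obtain d u' where du: "u = d # u'"
            by (cases u) auto
          have "(b, d) \<in> r" "rising r u"
            using rv bu du by (auto simp: rising_Cons_Cons)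
          moreover have "(d, b') \<in> r"
            using rising_starts_with_least[OF quot(2,1)[OF b] _ _ b'g] u du \<open>rising r u\<close> by blast
          ultimately have "(b, b') \<in> r"
            using order_trans by blast
          \<comment> \<open>The factorization of \<open>h\<close> starting with its least atom
            \<open>m\<close> is rising as well, so compatibility identifies it with
            \<open>[b, b']\<close>. Then \<open>b\<close> would precede \<open>a'\<close>.\<close>
          moreover obtain m where m: "m \<in> gens_below G A h"
            and mmin: "\<And>e. e \<in> gens_below G A h \<Longrightarrow> (m, e) \<in> r"
            using least[OF hc] lh by (metis len_one zero_neq_numeral)
          moreover have mh: "[m, inv m \<otimes> h] \<in> Red G A h"
            using Red_pair_iff gens_belowD[OF m] lh by blast
          moreover have "(m, inv m \<otimes> h) \<in> r"
            using mmin Red_Cons_Cons_take2(8)[OF leD(1)[OF h(2)] mh] by blast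
          ultimately have "m = b"
            using cpt hc lh bb' unfolding compatible_def by (metis fst_conv snd_conv)
          moreover have "(m, a') \<in> r"
            using mmin a'h gens_belowD(4)[OF a'(4)] by (simp add: gens_below_iff)
          ultimately show False
            using a'(1,2) order_antisym by blast
        qed
        then show ?thesis
          using lex by blast
      qed
    qed
    then show ?thesis
      using aw raw unfolding rising_first_def by blast
  qed
qed

end

end

theorem theorem5p23:
  fixes G :: "('a, 'b) monoid_scheme" and A :: "'a set" and c :: 'a and r :: "('a \<times> 'a) set"
  assumes "group G"
    and "generated_as_monoid G A"
    and "conj_closed G A"
    and "c \<in> carrier G"
    and "finite (Red G A c)"
    and "linear_order_on (gens_below G A c) r"
  shows "EL_labeling (fact_poset G A c) (prefix_le G A) (natural_label G) r \<longleftrightarrow>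
         compatible G A c r \<and> totally_well_covered G A c r"
proof -
  interpret conj_generated_group G A
    using assms(1-3) by (simp add: conj_generated_group_def conj_generated_group_axioms_def)
  show ?thesis
    using EL_labeling_iff_rising_first[OF assms(4)] compatible_if_rising_first[OF assms(6)]
      totally_well_covered_if_rising_first[OF assms(6)]
      rising_first_if_compatible[OF assms(6,5)] by blast
qed

end
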